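(* Consider an active perception POMDP with belief-based reward $\rho$. If for all policies $\pi$ (and all $t\ge1$) the action-value function $Q^\pi_t(b,\mathfrak a)$ is, for every belief $b$, non-negative, monotone and submodular in $\mathfrak a\subseteq A^+$, then for all beliefs $b$ (and all $t\ge0$), $$V^{G}_{t}(b)\ \ge\ (1-e^{-1})^{2t}\,V^{*}_{t}(b).$$
   Context: Active perception POMDP: finite state set $S$; $N$ sensors $A^+=\{1,\dots,N\}$; an action is a set $\mathfrak a\subseteq A^+$ of selected sensors, and the allowed actions are $A=\{\mathfrak a\subseteq A^+:|\mathfrak a|\le K\}$ with $1\le K\le N$. A belief $b$ is a probability distribution on $S$. The state evolves by $\Pr(s'|s)$, independently of the action; then an observation vector $\mathbf z=(z_1,\dots,z_N)$ from a finite set $\Omega$ is received with probability $O(s',\mathfrak a,\mathbf z)=\Pr(\mathbf z|s',\mathfrak a)$, where $z_i=\emptyset$ for $i\notin\mathfrak a$ (this is defined for every $\mathfrak a\subseteq A^+$). $\Pr(\mathbf z|\mathfrak a,b)$ is the probability of $\mathbf z$ when $\mathfrak a$ is taken in $b$, and $b^{\mathfrak a,\mathbf z}$ is the Bayes-updated belief over the new state (zero-probability observations are omitted from sums). The reward $\rho$ is a real function of beliefs (it does not depend on the action) and $\gamma\in[0,1]$ is a discount factor. A policy $\pi$ specifies an action in $A$ for each belief (and number of steps to go). $V^\pi_0(b)=\rho(b)$; for $t\ge1$ and $\mathfrak a\subseteq A^+$, $Q^\pi_t(b,\mathfrak a)=\rho(b)+\gamma\sum_{\mathbf z\in\Omega}\Pr(\mathbf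 z|\mathfrak a,b)V^\pi_{t-1}(b^{\mathfrak a,\mathbf z})$, and $V^\pi_t(b)=Q^\pi_t(b,\mathfrak a_\pi)$ with $\mathfrak a_\pi$ the action chosen by $\pi$ at $b$ with $t$ steps to go. Optimal value function: $V^*_0=\rho$, $V^*_t(b)=\max_{\mathfrak a\in A}\big[\rho(b)+\gamma\sum_{\mathbf z}\Pr(\mathbf z|\mathfrak a,b)V^*_{t-1}(b^{\mathfrak a,\mathbf z})\big]$. Greedy maximization: for a set function $f:2^{A^+}\to\mathbb R$, greedy-argmax$(f,A^+,K)$ starts with $Y=\emptyset$ and $K$ times replaces $Y$ by $Y\cup\{e\}$ with $e\in A^+\setminus Y$ maximizing $f(Y\cup\{e\})-f(Y)$ (ties broken by some fixed rule), and returns $Y$; $\max^G_{\mathfrak a}f(\mathfrak a)$ denotes $f$ evaluated at this output. Greedy value function: $V^G_0=\rho$, $V^G_t(b)=\max^{G}_{\mathfrak a}\big[\rho(b)+\gamma\sum_{\mathbf z}\Pr(\mathbf z|\mathfrak a,b)V^G_{t-1}(b^{\mathfrak a,\mathbf z})\big]$. A set function $f:2^{A^+}\to\mathbb R$ is monotone if $f(\mathfrak a_M)\le f(\mathfrak a_N)$ whenever $\mathfrak a_M\subseteq\mathfrak a_N$, and submodular if $f(\mathfrak a_M\cup\mathfrak a_N)+f(\mathfrak a_M\cap\mathfrak a_N)\le f(\mathfrak a_M)+f(\mathfrak a_N)$ for all $\mathfrak a_M,\mathfrak a_N\subseteq A^+$. *)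

theory Defs
  imports "HOL-Probability.Probability"
begin

text \<open>
  Sensors are the numbers from 1 to \<open>nsensors\<close>; an action is a set of selected sensors.
  Beliefs are probability mass functions on the finite type of states.  An observation vector is
  a function from sensor indices to \<open>'z option\<close>, where \<open>None\<close> is the null observation of a sensor
  that was not selected.
\<close>

record ('s, 'z) pomdp =
  nsensors :: nat
  budget :: nat
  trans_prob :: "'s \<Rightarrow> 's pmf"
  obs_space :: "(nat \<Rightarrow> 'z option) set"
  obs_dist :: "'s \<Rightarrow> nat set \<Rightarrow> (nat \<Rightarrow> 'z option) pmf"
  reward :: "'s pmf \<Rightarrow> real"
  discount :: real

definition sensors :: "('s, 'z) pomdp \<Rightarrow> nat set" where
  "sensors M = {1..nsensors M}"

definition actions :: "('s, 'z) pomdp \<Rightarrow> nat set set" where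
  "actions M = {a. a \<subseteq> sensors M \<and> card a \<le> budget M}"

text \<open>
  \<open>obs_dist M s' a\<close> is constrained for every set of sensors \<open>a\<close>, not only for those within the
  budget, since action values are evaluated on all sets of sensors.
\<close>

definition active_perception_pomdp :: "('s::finite, 'z) pomdp \<Rightarrow> bool" where
  "active_perception_pomdp M \<longleftrightarrow>
     1 \<le> budget M \<and> budget M \<le> nsensors M \<and>
     finite (obs_space M) \<and>
     (\<forall>z\<in>obs_space M. \<forall>i. i \<notin> sensors M \<longrightarrow> z i = None) \<and>
     (\<forall>s' a. a \<subseteq> sensors M \<longrightarrow> set_pmf (obs_dist M s' a) \<subseteq> obs_space M) \<and>
     (\<forall>s' a. a \<subseteq> sensors M \<longrightarrow> (\<forall>z\<in>set_pmf (obs_dist M s' a). \<forall>i. i \<notin> a \<longrightarrow> z i = None)) \<and>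
     0 \<le> discount M \<and> discount M \<le> 1"

definition pred_prob :: "('s::finite, 'z) pomdp \<Rightarrow> 's pmf \<Rightarrow> 's \<Rightarrow> real" where
  "pred_prob M b s' = (\<Sum>s\<in>UNIV. pmf (trans_prob M s) s' * pmf b s)"

definition obs_prob ::
    "('s::finite, 'z) pomdp \<Rightarrow> 's pmf \<Rightarrow> nat set \<Rightarrow> (nat \<Rightarrow> 'z option) \<Rightarrow> real" where
  "obs_prob M b a z = (\<Sum>s'\<in>UNIV. pmf (obs_dist M s' a) z * pred_prob M b s')"

text \<open>Bayes' rule; meaningful only if \<open>obs_prob M b a z > 0\<close>.\<close>

definition belief_update ::
    "('s::finite, 'z) pomdp \<Rightarrow> 's pmf \<Rightarrow> nat set \<Rightarrow> (nat \<Rightarrow> 'z option) \<Rightarrow> 's pmf" where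
  "belief_update M b a z =
     embed_pmf (\<lambda>s'. pmf (obs_dist M s' a) z * pred_prob M b s' / obs_prob M b a z)"

lemma pred_prob_nonneg: "0 \<le> pred_prob M b s'"
  unfolding pred_prob_def by (intro sum_nonneg) simp

lemma pmf_belief_update:
  assumes "obs_prob M b a z > 0"
  shows "pmf (belief_update M b a z) s' =
           pmf (obs_dist M s' a) z * pred_prob M b s' / obs_prob M b a z"
proof -
  define f where "f = (\<lambda>s'. pmf (obs_dist M s' a) z * pred_prob M b s' / obs_prob M b a z)"
  have nonneg: "0 \<le> f x" for x
    using assms by (simp add: f_def pred_prob_nonneg)
  have "(\<Sum>x\<in>UNIV. f x) = 1"
    using assms by (simp add: f_def obs_prob_def flip: sum_divide_distrib)
  then have "(\<integral>\<^sup>+ x. ennreal (f x) \<partial>count_space UNIV) = 1"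
    using nonneg by (simp add: nn_integral_count_space_finite sum_ennreal)
  then show ?thesis
    using nonneg unfolding belief_update_def f_def[symmetric]
    by (simp add: pmf_embed_pmf) (simp add: f_def)
qed

text \<open>One-step lookahead value of action \<open>a\<close> in belief \<open>b\<close>, where \<open>V\<close> values the next belief.\<close>

definition lookahead ::
    "('s::finite, 'z) pomdp \<Rightarrow> ('s pmf \<Rightarrow> real) \<Rightarrow> 's pmf \<Rightarrow> nat set \<Rightarrow> real" where
  "lookahead M V b a = reward M b + discount M *
     (\<Sum>z | z \<in> obs_space M \<and> obs_prob M b a z > 0. obs_prob M b a z * V (belief_update M b a z))"

text \<open>\<open>\<pi> t b\<close> is the action chosen in belief \<open>b\<close> with \<open>t\<close> steps to go.\<close>

definition policy :: "('s, 'z) pomdp \<Rightarrow> (nat \<Rightarrow> 's pmf \<Rightarrow> nat set) \<Rightarrow> bool" where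
  "policy M \<pi> \<longleftrightarrow> (\<forall>t b. \<pi> t b \<in> actions M)"

primrec V_pol ::
    "('s::finite, 'z) pomdp \<Rightarrow> (nat \<Rightarrow> 's pmf \<Rightarrow> nat set) \<Rightarrow> nat \<Rightarrow> 's pmf \<Rightarrow> real" where
  "V_pol M \<pi> 0 = reward M"
| "V_pol M \<pi> (Suc t) = (\<lambda>b. lookahead M (V_pol M \<pi> t) b (\<pi> (Suc t) b))"

text \<open>Only used for \<open>t \<ge> 1\<close>.\<close>

definition Q_pol ::
    "('s::finite, 'z) pomdp \<Rightarrow> (nat \<Rightarrow> 's pmf \<Rightarrow> nat set) \<Rightarrow> nat \<Rightarrow> 's pmf \<Rightarrow> nat set \<Rightarrow> real" where
  "Q_pol M \<pi> t b a = lookahead M (V_pol M \<pi> (t - 1)) b a"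

primrec V_opt :: "('s::finite, 'z) pomdp \<Rightarrow> nat \<Rightarrow> 's pmf \<Rightarrow> real" where
  "V_opt M 0 = reward M"
| "V_opt M (Suc t) = (\<lambda>b. Max (lookahead M (V_opt M t) b ` actions M))"

text \<open>
  A tie-breaking rule picks an element of every nonempty candidate set \<open>C\<close>; it may also look at
  the set \<open>Y\<close> of elements chosen so far.
\<close>

definition tie_rule :: "'a set \<Rightarrow> ('a set \<Rightarrow> 'a set \<Rightarrow> 'a) \<Rightarrow> bool" where
  "tie_rule X tie \<longleftrightarrow> (\<forall>Y C. C \<subseteq> X \<and> C \<noteq> {} \<longrightarrow> tie Y C \<in> C)"

primrec greedy_argmax ::
    "('a set \<Rightarrow> 'a set \<Rightarrow> 'a) \<Rightarrow> ('a set \<Rightarrow> real) \<Rightarrow> 'a set \<Rightarrow> nat \<Rightarrow> 'a set" where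
  "greedy_argmax tie f X 0 = {}"
| "greedy_argmax tie f X (Suc k) =
     (let Y = greedy_argmax tie f X k
      in Y \<union> {tie Y {e. is_arg_max (\<lambda>e. f (Y \<union> {e}) - f Y) (\<lambda>e. e \<in> X - Y) e}})"

definition greedy_max ::
    "('a set \<Rightarrow> 'a set \<Rightarrow> 'a) \<Rightarrow> ('a set \<Rightarrow> real) \<Rightarrow> 'a set \<Rightarrow> nat \<Rightarrow> real" where
  "greedy_max tie f X K = f (greedy_argmax tie f X K)"

primrec V_greedy ::
    "(nat set \<Rightarrow> nat set \<Rightarrow> nat) \<Rightarrow> ('s::finite, 'z) pomdp \<Rightarrow> nat \<Rightarrow> 's pmf \<Rightarrow> real" where
  "V_greedy tie M 0 = reward M"
| "V_greedy tie M (Suc t) =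
     (\<lambda>b. greedy_max tie (lookahead M (V_greedy tie M t) b) (sensors M) (budget M))"

definition submodular_on :: "'a set \<Rightarrow> ('a set \<Rightarrow> real) \<Rightarrow> bool" where
  "submodular_on X f \<longleftrightarrow> (\<forall>A B. A \<subseteq> X \<longrightarrow> B \<subseteq> X \<longrightarrow> f (A \<union> B) + f (A \<inter> B) \<le> f A + f B)"

end

theory Submission
  imports Defs
begin

text \<open>
  The greedy value function is the value function of a policy, so the set functions that it
  maximizes greedily are action values and hence monotone and submodular.  The reward may be
  negative, so the factor \<open>c = 1 - exp (-1)\<close> cannot be pulled out of the lookahead directly.
  Instead, values are compared with those of the policy that never selects a sensor: the greedy
  bound \<open>f Y - f {} \<ge> c * (f a - f {})\<close> propagates as
  \<open>V_greedy \<ge> (1 - c ^ t) * V_empty + c ^ t * V_opt\<close>, and \<open>0 \<le> V_empty \<le> V_opt\<close> for \<open>t \<ge> 1\<close>.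
\<close>

section \<open>Greedy maximization of monotone submodular set functions\<close>

lemma greedy_argmax_Suc:
  assumes "finite X" "tie_rule X tie" "greedy_argmax tie f X k \<subset> X"
  obtains e where "e \<in> X - greedy_argmax tie f X k"
    "greedy_argmax tie f X (Suc k) = insert e (greedy_argmax tie f X k)"
    "\<And>x. x \<in> X - greedy_argmax tie f X k \<Longrightarrow>
       f (insert x (greedy_argmax tie f X k)) \<le> f (insert e (greedy_argmax tie f X k))"
proof -
  define Y where "Y = greedy_argmax tie f X k"
  define g where "g = (\<lambda>e. f (Y \<union> {e}) - f Y)"
  define C where "C = {e. is_arg_max g (\<lambda>e. e \<in> X - Y) e}"
  have fin: "finite (X - Y)" and ne: "X - Y \<noteq> {}"
    using assms by (auto simp: Y_def)
  \<comment> \<open>\<open>tie_rule\<close> constrains the choice only on nonempty candidate sets,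
    so a maximizer of the gain is exhibited first.\<close>
  have "Max (g ` (X - Y)) \<in> g ` (X - Y)"
    using fin ne by (intro Max_in) auto
  then obtain x where "x \<in> X - Y" "g x = Max (g ` (X - Y))"
    by auto
  then have "x \<in> C"
    using fin by (auto simp: C_def is_arg_max_linorder)
  moreover have "C \<subseteq> X"
    by (auto simp: C_def is_arg_max_def)
  ultimately have tie: "tie Y C \<in> C"
    using assms(2) by (auto simp: tie_rule_def)
  show thesis
  proof (rule that[of "tie Y C"])
    show "tie Y C \<in> X - greedy_argmax tie f X k"
      using tie by (auto simp: C_def is_arg_max_def Y_def)
    show "greedy_argmax tie f X (Suc k) = insert (tie Y C) (greedy_argmax tie f X k)"
      by (simp add: Let_def C_def g_def Y_def)
    show "f (insert x (greedy_argmax tie f X k))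
        \<le> f (insert (tie Y C) (greedy_argmax tie f X k))"
      if "x \<in> X - greedy_argmax tie f X k" for x
      using tie that by (auto simp: C_def is_arg_max_linorder g_def Y_def)
  qed
qed

text \<open>The bound \<open>k \<le> card X\<close> leaves a fresh element for every step; once
  \<open>X\<close> is exhausted the candidate set is empty and \<open>tie\<close> may return
  anything.\<close>

lemma greedy_argmax_subset_card:
  assumes "finite X" "tie_rule X tie" "k \<le> card X"
  shows "greedy_argmax tie f X k \<subseteq> X \<and> card (greedy_argmax tie f X k) = k"
  using assms(3)
proof (induction k)
  case (Suc k)
  then have Y: "greedy_argmax tie f X k \<subseteq> X" "card (greedy_argmax tie f X k) = k"
    by auto
  then have "greedy_argmax tie f X k \<subset> X"
    using Suc.prems by auto
  then obtain e where "e \<in> X - greedy_argmax tie f X k"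
    "greedy_argmax tie f X (Suc k) = insert e (greedy_argmax tie f X k)"
    by (rule greedy_argmax_Suc[OF assms(1,2)])
  then show ?case
    using Y assms(1) by (auto simp del: greedy_argmax.simps simp: card_insert_if finite_subset)
qed simp

text \<open>Diminishing returns, one element at a time: \<open>A \<union> Y\<close> and
  \<open>insert e Y\<close> meet exactly in \<open>Y\<close>, so \<open>e\<close> gains no more over
  \<open>A \<union> Y\<close> than over \<open>Y\<close>.\<close>

lemma submodular_on_union_le:
  assumes sub: "submodular_on X f" and "finite A" "A \<subseteq> X" "Y \<subseteq> X" "A \<inter> Y = {}"
  shows "f (A \<union> Y) \<le> f Y + (\<Sum>e\<in>A. f (insert e Y) - f Y)"
  using assms(2,3,5)
proof (induction A rule: finite_induct)
  case (insert e A)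
  have "f ((A \<union> Y) \<union> insert e Y) + f ((A \<union> Y) \<inter> insert e Y) \<le> f (A \<union> Y) + f (insert e Y)"
    using sub insert.prems \<open>Y \<subseteq> X\<close> unfolding submodular_on_def
    by (metis Un_subset_iff insert_subset)
  moreover have "(A \<union> Y) \<union> insert e Y = insert e A \<union> Y" "(A \<union> Y) \<inter> insert e Y = Y"
    using insert.hyps insert.prems by auto
  ultimately show ?case
    using insert by simp
qed simp

text \<open>The gap to \<open>a\<close> is covered by the gains over \<open>Y\<close> of the at most
  \<open>K\<close> elements of \<open>a - Y\<close>, and none of them beats the gain of the greedy
  element.\<close>

lemma greedy_gap_step:
  assumes X: "finite X" and tie: "tie_rule X tie"
    and mono: "mono_on (Pow X) f" and sub: "submodular_on X f"
    and a: "a \<subseteq> X" "card a \<le> K" and k: "k < card X"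
  shows "f a - f (greedy_argmax tie f X k)
    \<le> real K * (f (greedy_argmax tie f X (Suc k)) - f (greedy_argmax tie f X k))"
proof -
  define Y where "Y = greedy_argmax tie f X k"
  have Y: "Y \<subseteq> X" "card Y = k"
    using greedy_argmax_subset_card[OF X tie, of k f] k by (auto simp: Y_def)
  then have "Y \<subset> X"
    using k by auto
  then obtain e where e: "e \<in> X - Y" "greedy_argmax tie f X (Suc k) = insert e Y"
    "\<And>x. x \<in> X - Y \<Longrightarrow> f (insert x Y) \<le> f (insert e Y)"
    using greedy_argmax_Suc[OF X tie, of f k] unfolding Y_def by blast
  define g where "g = f (insert e Y) - f Y"
  \<comment> \<open>The sign permits enlarging \<open>card (a - Y)\<close> to \<open>K\<close> at
    the end.\<close>
  have g: "0 \<le> g"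
    using mono_onD[OF mono, of Y "insert e Y"] e Y by (auto simp: g_def)
  have fin: "finite a"
    using a X finite_subset by blast
  have "f a \<le> f ((a - Y) \<union> Y)"
    using a Y by (intro mono_onD[OF mono]) auto
  also have "\<dots> \<le> f Y + (\<Sum>x\<in>a - Y. f (insert x Y) - f Y)"
    using a Y fin by (intro submodular_on_union_le[OF sub]) auto
  also have "(\<Sum>x\<in>a - Y. f (insert x Y) - f Y) \<le> (\<Sum>x\<in>a - Y. g)"
    using e a by (intro sum_mono) (auto simp: g_def)
  also have "\<dots> = real (card (a - Y)) * g"
    by simp
  also have "\<dots> \<le> real K * g"
    using g a(2) card_mono[OF fin, of "a - Y"] by (intro mult_right_mono) auto
  finally show ?thesis
    unfolding e(2) g_def Y_def[symmetric] by simp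
qed

text \<open>This is \<open>1 + x \<le> exp x\<close> at \<open>x = - 1 / K\<close>, raised to the
  power \<open>K\<close>; the base is non-negative since \<open>K \<ge> 1\<close>.\<close>

lemma one_minus_inverse_power_le:
  assumes "1 \<le> (K :: nat)"
  shows "(1 - 1 / real K) ^ K \<le> exp (- 1)"
proof -
  have "(1 - 1 / real K) ^ K \<le> exp (- 1 / real K) ^ K"
    using assms exp_ge_add_one_self[of "- 1 / real K"] by (intro power_mono) auto
  also have "\<dots> = exp (- 1)"
    using assms by (simp flip: exp_of_nat_mult)
  finally show ?thesis .
qed

text \<open>The Nemhauser--Wolsey--Fisher bound, for functions that need not vanish at \<open>{}\<close>.\<close>

lemma greedy_argmax_bound:
  assumes X: "finite X" and tie: "tie_rule X tie"
    and mono: "mono_on (Pow X) f" and sub: "submodular_on X f"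
    and a: "a \<subseteq> X" "card a \<le> K" and K: "1 \<le> K" "K \<le> card X"
  shows "(1 - exp (- 1)) * f a + exp (- 1) * f {} \<le> f (greedy_argmax tie f X K)"
proof -
  define d where "d k = f a - f (greedy_argmax tie f X k)" for k
  define r where "r = 1 - 1 / real K"
  have r: "0 \<le> r"
    using K by (simp add: r_def)
  \<comment> \<open>The greedy gain is \<open>d k - d (Suc k)\<close>, so the gap bound becomes a
    contraction by \<open>r\<close>, whatever the sign of \<open>d k\<close>.\<close>
  have step: "d (Suc k) \<le> r * d k" if "k < K" for k
  proof -
    have "d k \<le> real K * (d k - d (Suc k))"
      using greedy_gap_step[OF X tie mono sub a, of k] that K by (simp add: d_def)
    then show ?thesis
      using K by (simp add: r_def field_simps)
  qed
  have "d k \<le> r ^ k * d 0" if "k \<le> K" for k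
    using that
  proof (induction k)
    case (Suc k)
    have "d (Suc k) \<le> r * d k"
      using step Suc.prems by simp
    also have "\<dots> \<le> r * (r ^ k * d 0)"
      using Suc r by (intro mult_left_mono) auto
    finally show ?case
      by (simp add: mult.assoc)
  qed simp
  then have "d K \<le> r ^ K * d 0"
    by simp
  \<comment> \<open>Greedy starts from \<open>{}\<close>, so \<open>d 0 = f a - f {}\<close>, which
    is non-negative by monotonicity.\<close>
  also have "\<dots> \<le> exp (- 1) * d 0"
    using one_minus_inverse_power_le[OF K(1)] mono_onD[OF mono, of "{}" a] a
    by (intro mult_right_mono) (auto simp: r_def d_def)
  finally show ?thesis
    by (simp add: d_def algebra_simps)
qed

section \<open>Lookahead, optimal values and their comparison with greedy values\<close>

lemma lookahead_mono:
  assumes "0 \<le> discount M" "\<And>b. V b \<le> W b"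
  shows "lookahead M V b a \<le> lookahead M W b a"
  unfolding lookahead_def using assms
  by (intro add_left_mono mult_left_mono sum_mono) auto

text \<open>The weights sum to 1, so the reward splits exactly, whatever its sign.\<close>

lemma lookahead_convex_combination:
  "lookahead M (\<lambda>b. (1 - k) * V b + k * W b) b a
    = (1 - k) * lookahead M V b a + k * lookahead M W b a"
  unfolding lookahead_def
  by (simp add: sum.distrib sum_distrib_left algebra_simps sum_subtractf)

lemma finite_actions: "finite (actions M)"
  by (rule finite_subset[of _ "Pow (sensors M)"]) (auto simp: actions_def sensors_def)

lemma empty_in_actions: "{} \<in> actions M"
  by (simp add: actions_def)

lemma lookahead_le_V_opt:
  "a \<in> actions M \<Longrightarrow> lookahead M (V_opt M t) b a \<le> V_opt M (Suc t) b"
  by (simp add: finite_actions)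

lemma V_opt_attained:
  obtains a where "a \<in> actions M" "V_opt M (Suc t) b = lookahead M (V_opt M t) b a"
proof -
  have "Max (lookahead M (V_opt M t) b ` actions M) \<in> lookahead M (V_opt M t) b ` actions M"
    using empty_in_actions[of M] by (intro Max_in) (auto simp: finite_actions)
  then show thesis
    using that by auto
qed

lemma V_pol_le_V_opt:
  assumes "0 \<le> discount M" "policy M \<pi>"
  shows "V_pol M \<pi> t b \<le> V_opt M t b"
proof (induction t arbitrary: b)
  case (Suc t)
  have "V_pol M \<pi> (Suc t) b \<le> lookahead M (V_opt M t) b (\<pi> (Suc t) b)"
    using lookahead_mono[OF assms(1) Suc.IH] by simp
  also have "\<dots> \<le> V_opt M (Suc t) b"
    using assms(2) by (intro lookahead_le_V_opt) (simp add: policy_def)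
  finally show ?case .
qed simp

definition greedy_policy ::
    "(nat set \<Rightarrow> nat set \<Rightarrow> nat) \<Rightarrow> ('s::finite, 'z) pomdp \<Rightarrow> nat \<Rightarrow> 's pmf \<Rightarrow> nat set" where
  "greedy_policy tie M t b =
     greedy_argmax tie (lookahead M (V_greedy tie M (t - 1)) b) (sensors M) (budget M)"

lemma V_pol_greedy_policy: "V_pol M (greedy_policy tie M) t = V_greedy tie M t"
  by (induction t) (simp_all add: greedy_policy_def greedy_max_def)

lemma policy_greedy_policy:
  assumes "active_perception_pomdp M" "tie_rule (sensors M) tie"
  shows "policy M (greedy_policy tie M)"
  using greedy_argmax_subset_card[OF _ assms(2)] assms(1)
  by (auto simp: policy_def actions_def greedy_policy_def active_perception_pomdp_def sensors_def)

lemma V_greedy_ge_combination: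
  fixes M :: "('s::finite, 'z) pomdp"
  assumes M: "active_perception_pomdp M" and tie: "tie_rule (sensors M) tie"
    and Q: "\<And>\<pi> t b. policy M \<pi> \<Longrightarrow> t \<ge> 1 \<Longrightarrow>
           mono_on (Pow (sensors M)) (Q_pol M \<pi> t b) \<and>
           submodular_on (sensors M) (Q_pol M \<pi> t b)"
  shows "(1 - (1 - exp (- 1)) ^ t) * V_pol M (\<lambda>_ _. {}) t b + (1 - exp (- 1)) ^ t * V_opt M t b
    \<le> V_greedy tie M t b"
proof (induction t arbitrary: b)
  case (Suc t)
  define c :: real where "c = 1 - exp (- 1)"
  define E where "E = V_pol M (\<lambda>_ _. {})"
  define f where "f = lookahead M (V_greedy tie M t) b"
  have c: "0 \<le> c" "c \<le> 1"
    by (auto simp: c_def)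
  have \<gamma>: "0 \<le> discount M"
    using M by (simp add: active_perception_pomdp_def)
  have pol: "policy M (\<lambda>_ _. {})"
    by (simp add: policy_def empty_in_actions)
  obtain a where a: "a \<in> actions M" "V_opt M (Suc t) b = lookahead M (V_opt M t) b a"
    by (rule V_opt_attained)
  have f_ge: "(1 - c ^ t) * lookahead M (E t) b x + c ^ t * lookahead M (V_opt M t) b x \<le> f x"
    for x
    unfolding f_def lookahead_convex_combination[symmetric] using Suc.IH
    by (intro lookahead_mono[OF \<gamma>]) (simp add: E_def c_def)
  \<comment> \<open>Monotonicity of the action value of the no-sensor policy lets \<open>{}\<close>
    replace \<open>a\<close>, which turns the first term into \<open>E (Suc t) b\<close>.\<close>
  have "lookahead M (E t) b {} \<le> lookahead M (E t) b a"
    using mono_onD[of "Pow (sensors M)" "Q_pol M (\<lambda>_ _. {}) (Suc t) b" "{}" a] Q[OF pol, of "Suc t" b] a(1)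
    by (simp add: Q_pol_def E_def actions_def)
  then have "(1 - c ^ t) * E (Suc t) b \<le> (1 - c ^ t) * lookahead M (E t) b a"
    using c by (intro mult_left_mono) (auto simp: E_def power_le_one)
  then have fa: "(1 - c ^ t) * E (Suc t) b + c ^ t * V_opt M (Suc t) b \<le> f a"
    using f_ge[of a] a(2) by simp
  \<comment> \<open>At \<open>{}\<close> both terms of the combination dominate
    \<open>E (Suc t) b\<close>.\<close>
  have "E (Suc t) b \<le> lookahead M (V_opt M t) b {}"
    using lookahead_mono[OF \<gamma> V_pol_le_V_opt[OF \<gamma> pol]] by (simp add: E_def)
  then have "c ^ t * E (Suc t) b \<le> c ^ t * lookahead M (V_opt M t) b {}"
    using c by (intro mult_left_mono) auto
  then have f0: "E (Suc t) b \<le> f {}"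
    using f_ge[of "{}"] by (simp add: E_def algebra_simps)
  have "f = Q_pol M (greedy_policy tie M) (Suc t) b"
    by (rule ext) (simp add: f_def Q_pol_def V_pol_greedy_policy)
  then have "mono_on (Pow (sensors M)) f" "submodular_on (sensors M) f"
    using Q[OF policy_greedy_policy[OF M tie], of "Suc t" b] by auto
  then have "c * f a + (1 - c) * f {} \<le> V_greedy tie M (Suc t) b"
    using greedy_argmax_bound[OF _ tie, of f a "budget M"] a(1) M
    by (auto simp: active_perception_pomdp_def actions_def sensors_def greedy_max_def f_def c_def)
  moreover have "c * ((1 - c ^ t) * E (Suc t) b + c ^ t * V_opt M (Suc t) b)
      + (1 - c) * E (Suc t) b \<le> c * f a + (1 - c) * f {}"
    using fa f0 c by (intro add_mono mult_left_mono) auto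
  \<comment> \<open>The coefficient of \<open>E (Suc t) b\<close> is
    \<open>c * (1 - c ^ t) + (1 - c) = 1 - c ^ Suc t\<close>.\<close>
  ultimately have "(1 - c ^ Suc t) * E (Suc t) b + c ^ Suc t * V_opt M (Suc t) b
      \<le> V_greedy tie M (Suc t) b"
    by (simp del: V_opt.simps V_greedy.simps add: algebra_simps)
  then show ?case
    unfolding c_def E_def .
qed simp

theorem theorem4:
  fixes M :: "('s::finite, 'z) pomdp"
    and tie :: "nat set \<Rightarrow> nat set \<Rightarrow> nat"
    and b :: "'s pmf"
    and t :: nat
  assumes "active_perception_pomdp M"
    and "tie_rule (sensors M) tie"
    and "\<And>\<pi> t b. policy M \<pi> \<Longrightarrow> t \<ge> 1 \<Longrightarrow>
           (\<forall>a. a \<subseteq> sensors M \<longrightarrow> 0 \<le> Q_pol M \<pi> t b a) \<and>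
           mono_on (Pow (sensors M)) (Q_pol M \<pi> t b) \<and>
           submodular_on (sensors M) (Q_pol M \<pi> t b)"
  shows "V_greedy tie M t b \<ge> (1 - exp (- 1)) ^ (2 * t) * V_opt M t b"
proof (cases t)
  case (Suc n)
  define c :: real where "c = 1 - exp (- 1)"
  have c: "0 \<le> c" "c \<le> 1"
    by (auto simp: c_def)
  have pol: "policy M (\<lambda>_ _. {})"
    by (simp add: policy_def empty_in_actions)
  \<comment> \<open>Here \<open>t \<ge> 1\<close>, so this is the action value of \<open>{}\<close>
    and hence non-negative. For \<open>t = 0\<close> both sides equal the reward, which may be
    negative.\<close>
  have E: "0 \<le> V_pol M (\<lambda>_ _. {}) t b"
    using assms(3)[OF pol, of t b] Suc by (auto simp: Q_pol_def)
  have "V_pol M (\<lambda>_ _. {}) t b \<le> V_opt M t b"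
    using assms(1) by (intro V_pol_le_V_opt pol) (simp add: active_perception_pomdp_def)
  \<comment> \<open>The combination yields the factor \<open>c ^ t\<close>; since
    \<open>V_opt M t b \<ge> 0\<close>, it may be lowered to \<open>c ^ (2 * t)\<close>.\<close>
  then have "c ^ (2 * t) * V_opt M t b \<le> c ^ t * V_opt M t b"
    using E c by (intro mult_right_mono power_decreasing) auto
  also have "\<dots> \<le> (1 - c ^ t) * V_pol M (\<lambda>_ _. {}) t b + c ^ t * V_opt M t b"
    using E c by (simp add: power_le_one)
  also have "\<dots> \<le> V_greedy tie M t b"
    unfolding c_def using assms by (intro V_greedy_ge_combination) auto
  finally show ?thesis
    by (simp add: c_def)
qed simp

end
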